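(* Let $(M,N,\nabla,\pi,h)$ be a weak contraction of chain complexes over a commutative ring $R$ with unit, with $\nabla\colon M\to N$, $\pi\colon N\to M$, $h\colon N\to N$; let $\partial$ be a perturbation of the differential $d$ on $N$, and suppose that the degree zero endomorphisms $\mathrm{Id}_N+h\partial$ and $\mathrm{Id}_N+\partial h$ of $N$ are invertible. Let $\alpha=(\mathrm{Id}_N+h\partial)^{-1}$, $\beta=(\mathrm{Id}_N+\partial h)^{-1}$, and $$\mathcal D=\pi\partial\alpha\nabla=\pi\beta\partial\nabla\colon M\to M,\quad \nabla_\partial=\alpha\nabla\colon M\to N,\quad \pi_\partial=\pi\beta\colon N\to M,\quad h_\partial=\alpha h=h\beta\colon N\to N.$$ Let $M_{\mathcal D}$ denote $M$ endowed with the operator $d+\mathcal D$ ($d$ the differential of $M$) and let $N_\partial$ denote $N$ endowed with $d+\partial$. Then $(M_{\mathcal D},N_\partial,\nabla_\partial,\pi_\partial,h_\partial)$ is a weak contraction.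
   Context: Chain complexes are over $R$, with differential of degree $-1$, always written $d$. For a homogeneous operator $f$ on $N$ of degree $1$, $Df=df+fd$. A weak contraction $(M,N,\nabla,\pi,h)$ consists of chain complexes $M$ and $N$, a surjective chain map $\pi\colon N\to M$, an injective chain map $\nabla\colon M\to N$, and a morphism $h\colon N\to N$ of the underlying graded modules of degree $1$, subject to $Dh=\mathrm{Id}_N-\nabla\pi$ and $hh=0$. A perturbation $\partial$ of the differential $d$ on $N$ is a homogeneous degree $-1$ operator $\partial$ on $N$ such that $d+\partial$ has square zero. *)

theory Defs
  imports "HOL-Algebra.Module"
begin

text \<open>
  A graded \<open>R\<close>-module is a family \<open>M :: int \<Rightarrow> _\<close> of \<open>R\<close>-modules; a map of graded modules is a
  family of functions \<open>f n\<close> on the components, of which only the values on the carriers matter.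
  The degree is not part of a map: \<open>f\<close> is of degree \<open>k\<close> if \<open>f n\<close> takes \<open>M n\<close> to \<open>N (n + k)\<close>,
  and \<open>k\<close> is an explicit argument wherever it is needed.
\<close>

type_synonym ('a, 'b) gmap = "int \<Rightarrow> 'a \<Rightarrow> 'b"

definition module_hom ::
  "('r, 'x) ring_scheme \<Rightarrow> ('r, 'a, 'y) module_scheme \<Rightarrow> ('r, 'b, 'z) module_scheme \<Rightarrow> ('a \<Rightarrow> 'b) set"
  where "module_hom R A B =
    {f \<in> hom (add_monoid A) (add_monoid B).
       \<forall>r\<in>carrier R. \<forall>x\<in>carrier A. f (r \<odot>\<^bsub>A\<^esub> x) = r \<odot>\<^bsub>B\<^esub> f x}"

definition gr_hom ::
  "('r, 'x) ring_scheme \<Rightarrow> (int \<Rightarrow> ('r, 'a, 'y) module_scheme) \<Rightarrow> (int \<Rightarrow> ('r, 'b, 'z) module_scheme)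
    \<Rightarrow> int \<Rightarrow> ('a, 'b) gmap set"
  where "gr_hom R A B k = {f. \<forall>n. f n \<in> module_hom R (A n) (B (n + k))}"

definition gr_eq ::
  "(int \<Rightarrow> ('r, 'a, 'y) module_scheme) \<Rightarrow> ('a, 'b) gmap \<Rightarrow> ('a, 'b) gmap \<Rightarrow> bool"
  where "gr_eq A f g \<longleftrightarrow> (\<forall>n. \<forall>x\<in>carrier (A n). f n x = g n x)"

text \<open>In \<open>g \<circ>\<^bsub>k\<^esub> f\<close> the index \<open>k\<close> is the degree of the inner map \<open>f\<close>.\<close>

definition gr_comp :: "('b, 'c) gmap \<Rightarrow> int \<Rightarrow> ('a, 'b) gmap \<Rightarrow> ('a, 'c) gmap"
    (\<open>(_ \<circ>\<^bsub>_\<^esub>/ _)\<close> [56, 0, 55] 55)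
  where "(g \<circ>\<^bsub>k\<^esub> f) = (\<lambda>n x. g (n + k) (f n x))"

definition gr_id :: "('a, 'a) gmap"
  where "gr_id = (\<lambda>n x. x)"

text \<open>Pointwise operations on maps of degree \<open>k\<close> with target \<open>B\<close>.\<close>

definition gr_zero :: "(int \<Rightarrow> ('r, 'b, 'z) module_scheme) \<Rightarrow> int \<Rightarrow> ('a, 'b) gmap"
  where "gr_zero B k = (\<lambda>n x. \<zero>\<^bsub>B (n + k)\<^esub>)"

definition gr_add ::
  "(int \<Rightarrow> ('r, 'b, 'z) module_scheme) \<Rightarrow> int \<Rightarrow> ('a, 'b) gmap \<Rightarrow> ('a, 'b) gmap \<Rightarrow> ('a, 'b) gmap"
  where "gr_add B k f g = (\<lambda>n x. f n x \<oplus>\<^bsub>B (n + k)\<^esub> g n x)"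

definition gr_diff ::
  "(int \<Rightarrow> ('r, 'b, 'z) module_scheme) \<Rightarrow> int \<Rightarrow> ('a, 'b) gmap \<Rightarrow> ('a, 'b) gmap \<Rightarrow> ('a, 'b) gmap"
  where "gr_diff B k f g = (\<lambda>n x. f n x \<ominus>\<^bsub>B (n + k)\<^esub> g n x)"

definition gr_invertible ::
  "('r, 'x) ring_scheme \<Rightarrow> (int \<Rightarrow> ('r, 'a, 'y) module_scheme) \<Rightarrow> ('a, 'a) gmap \<Rightarrow> bool"
  where "gr_invertible R A f \<longleftrightarrow>
    f \<in> gr_hom R A A 0 \<and>
    (\<exists>g\<in>gr_hom R A A 0. gr_eq A (g \<circ>\<^bsub>0\<^esub> f) gr_id \<and> gr_eq A (f \<circ>\<^bsub>0\<^esub> g) gr_id)"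

definition gr_inv ::
  "(int \<Rightarrow> ('r, 'a, 'y) module_scheme) \<Rightarrow> ('a, 'a) gmap \<Rightarrow> ('a, 'a) gmap"
  where "gr_inv A f = (\<lambda>n. inv_into (carrier (A n)) (f n))"

definition chain_complex ::
  "('r, 'x) ring_scheme \<Rightarrow> (int \<Rightarrow> ('r, 'a, 'y) module_scheme) \<Rightarrow> ('a, 'a) gmap \<Rightarrow> bool"
  where "chain_complex R M d \<longleftrightarrow>
    (\<forall>n. module R (M n)) \<and> d \<in> gr_hom R M M (-1) \<and> gr_eq M (d \<circ>\<^bsub>-1\<^esub> d) (gr_zero M (-2))"

definition chain_map ::
  "('r, 'x) ring_scheme \<Rightarrow> (int \<Rightarrow> ('r, 'a, 'y) module_scheme) \<Rightarrow> ('a, 'a) gmap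
    \<Rightarrow> (int \<Rightarrow> ('r, 'b, 'z) module_scheme) \<Rightarrow> ('b, 'b) gmap \<Rightarrow> ('a, 'b) gmap \<Rightarrow> bool"
  where "chain_map R M dM N dN f \<longleftrightarrow>
    f \<in> gr_hom R M N 0 \<and> gr_eq M (dN \<circ>\<^bsub>0\<^esub> f) (f \<circ>\<^bsub>-1\<^esub> dM)"

text \<open>The operator \<open>D f = d f + f d\<close> for \<open>f\<close> of degree \<open>1\<close>.\<close>

definition hom_diff ::
  "(int \<Rightarrow> ('r, 'a, 'y) module_scheme) \<Rightarrow> ('a, 'a) gmap \<Rightarrow> ('a, 'a) gmap \<Rightarrow> ('a, 'a) gmap"
  where "hom_diff N d f = gr_add N 0 (d \<circ>\<^bsub>1\<^esub> f) (f \<circ>\<^bsub>-1\<^esub> d)"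

definition weak_contraction ::
  "('r, 'x) ring_scheme \<Rightarrow> (int \<Rightarrow> ('r, 'a, 'y) module_scheme) \<Rightarrow> ('a, 'a) gmap
    \<Rightarrow> (int \<Rightarrow> ('r, 'b, 'z) module_scheme) \<Rightarrow> ('b, 'b) gmap
    \<Rightarrow> ('a, 'b) gmap \<Rightarrow> ('b, 'a) gmap \<Rightarrow> ('b, 'b) gmap \<Rightarrow> bool"
  where "weak_contraction R M dM N dN nabla \<pi> h \<longleftrightarrow>
    chain_complex R M dM \<and> chain_complex R N dN \<and>
    chain_map R N dN M dM \<pi> \<and> (\<forall>n. \<pi> n ` carrier (N n) = carrier (M n)) \<and>
    chain_map R M dM N dN nabla \<and> (\<forall>n. inj_on (nabla n) (carrier (M n))) \<and>
    h \<in> gr_hom R N N 1 \<and>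
    gr_eq N (hom_diff N dN h) (gr_diff N 0 gr_id (nabla \<circ>\<^bsub>0\<^esub> \<pi>)) \<and>
    gr_eq N (h \<circ>\<^bsub>1\<^esub> h) (gr_zero N 2)"

definition perturbation ::
  "('r, 'x) ring_scheme \<Rightarrow> (int \<Rightarrow> ('r, 'a, 'y) module_scheme) \<Rightarrow> ('a, 'a) gmap \<Rightarrow> ('a, 'a) gmap \<Rightarrow> bool"
  where "perturbation R N d p \<longleftrightarrow>
    p \<in> gr_hom R N N (-1) \<and>
    gr_eq N (gr_add N (-1) d p \<circ>\<^bsub>-1\<^esub> gr_add N (-1) d p) (gr_zero N (-2))"

end

(* With d' = d + \<delta>, A = Id + h \<delta> and B = Id + \<delta> h, the two relations
     d h + h d + \<nabla> \<pi> = Id   and   d \<delta> + \<delta> d + \<delta> \<delta> = 0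
   give, without any side condition on h, \<nabla>, \<pi> and after cancelling the invertible A and B,
   the compatibility of A^-1 \<nabla> and \<pi> B^-1 with the perturbed differentials, as well as
     A d' h + h d' B = A B - \<nabla> \<pi>,
   which is the homotopy identity multiplied by A on the left and by B on the right.
   That d + D squares to zero on M then follows from d' d' = 0, because A^-1 \<nabla> is injective
   and intertwines d + D with d'. *)

theory Submission
  imports Defs
begin

section \<open>Maps of graded modules\<close>

lemma gr_homI:
  assumes "\<And>n x. x \<in> carrier (A n) \<Longrightarrow> f n x \<in> carrier (B (n + k))"
    and "\<And>n x y. x \<in> carrier (A n) \<Longrightarrow> y \<in> carrier (A n) \<Longrightarrow>
      f n (x \<oplus>\<^bsub>A n\<^esub> y) = f n x \<oplus>\<^bsub>B (n + k)\<^esub> f n y"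
    and "\<And>n r x. r \<in> carrier R \<Longrightarrow> x \<in> carrier (A n) \<Longrightarrow>
      f n (r \<odot>\<^bsub>A n\<^esub> x) = r \<odot>\<^bsub>B (n + k)\<^esub> f n x"
  shows "f \<in> gr_hom R A B k"
  using assms by (auto simp: gr_hom_def module_hom_def hom_def)

text \<open>The target degree is a variable tied by an equation, so that as a simp rule it also
  covers indices such as \<open>n - 1 + 1\<close>, which differ from \<open>n\<close> only by
  arithmetic.\<close>

lemma gr_hom_closed:
  assumes "f \<in> gr_hom R A B k" "x \<in> carrier (A n)" "m = n + k"
  shows "f n x \<in> carrier (B m)"
  using assms by (auto simp: gr_hom_def module_hom_def hom_def)

lemma gr_hom_add:
  assumes "f \<in> gr_hom R A B k" "x \<in> carrier (A n)" "y \<in> carrier (A n)"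
  shows "f n (x \<oplus>\<^bsub>A n\<^esub> y) = f n x \<oplus>\<^bsub>B (n + k)\<^esub> f n y"
  using assms by (auto simp: gr_hom_def module_hom_def hom_def)

lemma gr_hom_smult:
  assumes "f \<in> gr_hom R A B k" "r \<in> carrier R" "x \<in> carrier (A n)"
  shows "f n (r \<odot>\<^bsub>A n\<^esub> x) = r \<odot>\<^bsub>B (n + k)\<^esub> f n x"
  using assms by (auto simp: gr_hom_def module_hom_def)

lemma gr_hom_zero:
  assumes "f \<in> gr_hom R A B k" "module R (A n)" "module R (B (n + k))"
  shows "f n \<zero>\<^bsub>A n\<^esub> = \<zero>\<^bsub>B (n + k)\<^esub>"
proof -
  interpret A: module R "A n" by fact
  interpret B: module R "B (n + k)" by fact
  have "f n \<zero>\<^bsub>A n\<^esub> \<oplus>\<^bsub>B (n + k)\<^esub> f n \<zero>\<^bsub>A n\<^esub> = f n \<zero>\<^bsub>A n\<^esub>"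
    using gr_hom_add[OF assms(1), of "\<zero>\<^bsub>A n\<^esub>" n "\<zero>\<^bsub>A n\<^esub>"] by simp
  then show ?thesis
    using gr_hom_closed[OF assms(1) A.zero_closed refl] B.add.r_cancel_one' by metis
qed

lemma gr_hom_comp:
  assumes f: "f \<in> gr_hom R A B k" and g: "g \<in> gr_hom R B C l" and m: "m = k + l"
  shows "(g \<circ>\<^bsub>k\<^esub> f) \<in> gr_hom R A C m"
proof (rule gr_homI)
  \<comment> \<open>The rules for \<open>g\<close>, used in degree \<open>n + k\<close>, yield the
    bracketing \<open>n + k + l\<close>.\<close>
  have idx: "n + m = n + k + l" for n
    using m by simp
  show "(g \<circ>\<^bsub>k\<^esub> f) n x \<in> carrier (C (n + m))" if "x \<in> carrier (A n)" for n x
    unfolding gr_comp_def by (intro gr_hom_closed[OF g] gr_hom_closed[OF f] that refl idx)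
  show "(g \<circ>\<^bsub>k\<^esub> f) n (x \<oplus>\<^bsub>A n\<^esub> y) = (g \<circ>\<^bsub>k\<^esub> f) n x \<oplus>\<^bsub>C (n + m)\<^esub> (g \<circ>\<^bsub>k\<^esub> f) n y"
    if "x \<in> carrier (A n)" "y \<in> carrier (A n)" for n x y
    using that by (simp only: gr_comp_def idx gr_hom_add[OF f] gr_hom_add[OF g] gr_hom_closed[OF f])
  show "(g \<circ>\<^bsub>k\<^esub> f) n (r \<odot>\<^bsub>A n\<^esub> x) = r \<odot>\<^bsub>C (n + m)\<^esub> (g \<circ>\<^bsub>k\<^esub> f) n x"
    if "r \<in> carrier R" "x \<in> carrier (A n)" for n r x
    using that by (simp only: gr_comp_def idx gr_hom_smult[OF f] gr_hom_smult[OF g] gr_hom_closed[OF f])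
qed

lemma gr_hom_gr_add:
  assumes f: "f \<in> gr_hom R A B k" and g: "g \<in> gr_hom R A B k" and B: "\<And>n. module R (B n)"
  shows "gr_add B k f g \<in> gr_hom R A B k"
proof -
  interpret B: module R "B n" for n by (rule B)
  note closed = gr_hom_closed[OF f _ refl] gr_hom_closed[OF g _ refl]
  show ?thesis
    by (rule gr_homI)
      (simp_all add: gr_add_def closed gr_hom_add[OF f] gr_hom_add[OF g]
        gr_hom_smult[OF f] gr_hom_smult[OF g] B.smult_r_distr B.add.m_ac)
qed

lemma gr_hom_cong:
  assumes f: "f \<in> gr_hom R A B k" and eq: "gr_eq A f g" and A: "\<And>n. module R (A n)"
  shows "g \<in> gr_hom R A B k"
proof -
  interpret A: module R "A n" for n by (rule A)
  have "g n x = f n x" if "x \<in> carrier (A n)" for n x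
    using eq that by (simp add: gr_eq_def)
  then show ?thesis
    by (intro gr_homI)
      (simp_all add: gr_hom_closed[OF f] gr_hom_add[OF f] gr_hom_smult[OF f])
qed

section \<open>Inverses of degree zero endomorphisms\<close>

lemma gr_inv_bij_betw:
  assumes "gr_invertible R A f"
  shows "bij_betw (f n) (carrier (A n)) (carrier (A n))"
proof -
  obtain g where f: "f \<in> gr_hom R A A 0" and g: "g \<in> gr_hom R A A 0"
    and gf: "gr_eq A (g \<circ>\<^bsub>0\<^esub> f) gr_id" and fg: "gr_eq A (f \<circ>\<^bsub>0\<^esub> g) gr_id"
    using assms by (auto simp: gr_invertible_def)
  show ?thesis
    by (rule bij_betw_byWitness[where f' = "g n"])
      (use gf fg gr_hom_closed[OF f] gr_hom_closed[OF g] in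
        \<open>auto simp: gr_eq_def gr_comp_def gr_id_def\<close>)
qed

lemma gr_inv_left:
  assumes "gr_invertible R A f" "x \<in> carrier (A n)"
  shows "gr_inv A f n (f n x) = x"
  using gr_inv_bij_betw[OF assms(1), of n] assms(2) by (simp add: gr_inv_def bij_betw_inv_into_left)

lemma gr_inv_right:
  assumes "gr_invertible R A f" "x \<in> carrier (A n)"
  shows "f n (gr_inv A f n x) = x"
  using gr_inv_bij_betw[OF assms(1), of n] assms(2) by (simp add: gr_inv_def bij_betw_inv_into_right)

text \<open>Linearity is not visible in \<open>inv_into\<close>; it is inherited from the linear
  two-sided inverse that invertibility provides, because both agree on the carriers.\<close>

lemma gr_hom_gr_inv:
  assumes f: "gr_invertible R A f" and A: "\<And>n. module R (A n)"
  shows "gr_inv A f \<in> gr_hom R A A 0"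
proof -
  obtain g where g: "g \<in> gr_hom R A A 0" and fg: "gr_eq A (f \<circ>\<^bsub>0\<^esub> g) gr_id"
    using f by (auto simp: gr_invertible_def)
  have "gr_eq A g (gr_inv A f)"
    unfolding gr_eq_def
  proof (intro allI ballI)
    fix n x assume x: "x \<in> carrier (A n)"
    then have "g n x \<in> carrier (A n)"
      using gr_hom_closed[OF g] by simp
    from gr_inv_left[OF f this] show "g n x = gr_inv A f n x"
      using fg x by (simp add: gr_eq_def gr_comp_def gr_id_def)
  qed
  from gr_hom_cong[OF g this A] show ?thesis .
qed

section \<open>Cancellation in abelian monoids and groups\<close>

text \<open>Serves both chain map identities: \<open>p\<close> is split by the homotopy identity,
  and its middle summand \<open>v\<close> is cancelled by the perturbation relation.\<close>

lemma (in abelian_monoid) add_eq_cancel_zero: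
  assumes "p = w \<oplus> v \<oplus> u" "v \<oplus> (t \<oplus> s) = \<zero>"
    and [simp]: "e \<in> carrier G" "s \<in> carrier G" "t \<in> carrier G" "u \<in> carrier G"
      "v \<in> carrier G" "w \<in> carrier G"
  shows "e \<oplus> w \<oplus> u = e \<oplus> p \<oplus> (t \<oplus> s)"
proof -
  have "e \<oplus> p \<oplus> (t \<oplus> s) = e \<oplus> w \<oplus> u \<oplus> (v \<oplus> (t \<oplus> s))"
    by (simp add: assms(1) a_ac)
  then show ?thesis
    by (simp add: assms(2))
qed

text \<open>Serves the perturbed homotopy identity. The summand \<open>e\<close> occurs twice on the
  left: one copy vanishes together with \<open>k\<close> and \<open>c\<close>, the other
  survives.\<close>

lemma (in abelian_monoid) add_eq_cancel_zero':
  assumes "y = a \<oplus> f \<oplus> p" "k \<oplus> (c \<oplus> e) = \<zero>"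
    and [simp]: "a \<in> carrier G" "b \<in> carrier G" "c \<in> carrier G" "e \<in> carrier G" "f \<in> carrier G"
      "g \<in> carrier G" "k \<in> carrier G" "p \<in> carrier G"
  shows "a \<oplus> b \<oplus> (c \<oplus> e) \<oplus> (f \<oplus> k \<oplus> (g \<oplus> e)) \<oplus> p = y \<oplus> b \<oplus> (g \<oplus> e)"
proof -
  have "a \<oplus> b \<oplus> (c \<oplus> e) \<oplus> (f \<oplus> k \<oplus> (g \<oplus> e)) \<oplus> p
      = (a \<oplus> f \<oplus> p) \<oplus> b \<oplus> (g \<oplus> e) \<oplus> (k \<oplus> (c \<oplus> e))"
    by (simp add: a_ac)
  then show ?thesis
    by (simp add: assms(1,2))
qed

lemma (in abelian_group) eq_minus_iff:
  assumes "x \<in> carrier G" "y \<in> carrier G" "z \<in> carrier G"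
  shows "x = y \<ominus> z \<longleftrightarrow> x \<oplus> z = y"
  using assms by (metis a_minus_def add.inv_solve_right minus_closed add.m_comm)

section \<open>Perturbed weak contractions\<close>

locale perturbed_weak_contraction =
  fixes R :: "('r, 'x) ring_scheme"
    and M :: "int \<Rightarrow> ('r, 'a, 'y) module_scheme" and N :: "int \<Rightarrow> ('r, 'b, 'z) module_scheme"
    and dM :: "('a, 'a) gmap" and d \<delta> h :: "('b, 'b) gmap"
    and nabla :: "('a, 'b) gmap" and \<pi> :: "('b, 'a) gmap"
  assumes contraction: "weak_contraction R M dM N d nabla \<pi> h"
    and perturbation: "perturbation R N d \<delta>"
    and invertible_A: "gr_invertible R N (gr_add N 0 gr_id (h \<circ>\<^bsub>-1\<^esub> \<delta>))"
    and invertible_B: "gr_invertible R N (gr_add N 0 gr_id (\<delta> \<circ>\<^bsub>1\<^esub> h))"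
begin

definition \<alpha> where "\<alpha> = gr_inv N (gr_add N 0 gr_id (h \<circ>\<^bsub>-1\<^esub> \<delta>))"
definition \<beta> where "\<beta> = gr_inv N (gr_add N 0 gr_id (\<delta> \<circ>\<^bsub>1\<^esub> h))"
definition D where "D = \<pi> \<circ>\<^bsub>-1\<^esub> \<delta> \<circ>\<^bsub>0\<^esub> \<alpha> \<circ>\<^bsub>0\<^esub> nabla"
abbreviation dM' where "dM' \<equiv> gr_add M (-1) dM D"
abbreviation d' where "d' \<equiv> gr_add N (-1) d \<delta>"

section \<open>The hypotheses on elements\<close>

lemma module_M: "module R (M n)" and module_N: "module R (N n)"
  and hom_dM: "dM \<in> gr_hom R M M (-1)" and hom_d: "d \<in> gr_hom R N N (-1)"
  and hom_nabla: "nabla \<in> gr_hom R M N 0" and hom_\<pi>: "\<pi> \<in> gr_hom R N M 0"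
  and hom_h: "h \<in> gr_hom R N N 1" and hom_\<delta>: "\<delta> \<in> gr_hom R N N (-1)"
  using contraction perturbation
  by (simp_all add: weak_contraction_def chain_complex_def chain_map_def perturbation_def)

sublocale M: module R "M n" for n by (rule module_M)
sublocale N: module R "N n" for n by (rule module_N)

lemma hom_\<alpha>: "\<alpha> \<in> gr_hom R N N 0" and hom_\<beta>: "\<beta> \<in> gr_hom R N N 0"
  by (simp_all add: \<alpha>_def \<beta>_def gr_hom_gr_inv invertible_A invertible_B module_N)

lemma hom_D: "D \<in> gr_hom R M M (-1)"
  unfolding D_def by (rule gr_hom_comp hom_nabla hom_\<alpha> hom_\<delta> hom_\<pi> | simp)+

lemma D_apply: "D n x = \<pi> (n - 1) (\<delta> n (\<alpha> n (nabla n x)))"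
  by (simp add: D_def gr_comp_def)

lemmas homs = hom_dM hom_d hom_nabla hom_\<pi> hom_h hom_\<delta> hom_\<alpha> hom_\<beta> hom_D
lemmas hom_closed [simp] = homs[THEN gr_hom_closed]
text \<open>Distributes every map over sums by default, with target indices normalised to
  \<open>n\<close> or \<open>n - 1\<close>. It is deleted below wherever a sum has to stay intact to
  match the inverse laws.\<close>

lemmas hom_add [simp] = homs[THEN gr_hom_add, simplified]

lemma dd: "x \<in> carrier (N n) \<Longrightarrow> d (n - 1) (d n x) = \<zero>\<^bsub>N (n - 2)\<^esub>"
  and hh: "x \<in> carrier (N n) \<Longrightarrow> h (n + 1) (h n x) = \<zero>\<^bsub>N (n + 2)\<^esub>"
  and d_\<pi>: "x \<in> carrier (N n) \<Longrightarrow> dM n (\<pi> n x) = \<pi> (n - 1) (d n x)"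
  and d_nabla: "x' \<in> carrier (M n) \<Longrightarrow> d n (nabla n x') = nabla (n - 1) (dM n x')"
  using contraction
  by (auto simp: weak_contraction_def chain_complex_def chain_map_def gr_eq_def gr_comp_def gr_zero_def)

lemma homotopy:
  assumes x: "x \<in> carrier (N n)"
  shows "x = d (n + 1) (h n x) \<oplus>\<^bsub>N n\<^esub> h (n - 1) (d n x) \<oplus>\<^bsub>N n\<^esub> nabla n (\<pi> n x)"
proof -
  have "d (n + 1) (h n x) \<oplus>\<^bsub>N n\<^esub> h (n - 1) (d n x) = x \<ominus>\<^bsub>N n\<^esub> nabla n (\<pi> n x)"
    using contraction x
    by (auto simp: weak_contraction_def hom_diff_def gr_eq_def gr_comp_def gr_add_def gr_diff_def gr_id_def)
  then show ?thesis
    using x by (simp add: N.eq_minus_iff)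
qed

lemma d'_d':
  assumes "x \<in> carrier (N n)"
  shows "d' (n - 1) (d' n x) = \<zero>\<^bsub>N (n - 2)\<^esub>"
  using perturbation assms
  by (simp add: perturbation_def gr_eq_def gr_comp_def gr_zero_def)

text \<open>Expanding the square of \<open>d + \<delta>\<close> and dropping \<open>d d = 0\<close>
  leaves these three terms.\<close>

lemma perturbation_eq:
  assumes x: "x \<in> carrier (N n)"
  shows "d (n - 1) (\<delta> n x) \<oplus>\<^bsub>N (n - 2)\<^esub> (\<delta> (n - 1) (d n x) \<oplus>\<^bsub>N (n - 2)\<^esub> \<delta> (n - 1) (\<delta> n x))
    = \<zero>\<^bsub>N (n - 2)\<^esub>"
  using d'_d'[OF x] x by (simp add: gr_add_def dd N.add.m_ac)

lemma h_perturbation_eq: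
  assumes x: "x \<in> carrier (N n)"
  shows "h (n - 2) (d (n - 1) (\<delta> n x)) \<oplus>\<^bsub>N (n - 1)\<^esub>
    (h (n - 2) (\<delta> (n - 1) (d n x)) \<oplus>\<^bsub>N (n - 1)\<^esub> h (n - 2) (\<delta> (n - 1) (\<delta> n x))) = \<zero>\<^bsub>N (n - 1)\<^esub>"
  using arg_cong[OF perturbation_eq[OF x], of "h (n - 2)"] gr_hom_zero[OF hom_h, of "n - 2"] x
  by (simp add: module_N)

section \<open>Commutation rules for the inverses\<close>

lemma \<alpha>_left: "x \<in> carrier (N n) \<Longrightarrow> \<alpha> n (x \<oplus>\<^bsub>N n\<^esub> h (n - 1) (\<delta> n x)) = x"
  and \<alpha>_right: "x \<in> carrier (N n) \<Longrightarrow> \<alpha> n x \<oplus>\<^bsub>N n\<^esub> h (n - 1) (\<delta> n (\<alpha> n x)) = x"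
  using gr_inv_left[OF invertible_A, of x n] gr_inv_right[OF invertible_A, of x n]
  by (simp_all add: \<alpha>_def \<beta>_def gr_add_def gr_comp_def gr_id_def del: hom_add)

lemma \<beta>_left: "x \<in> carrier (N n) \<Longrightarrow> \<beta> n (x \<oplus>\<^bsub>N n\<^esub> \<delta> (n + 1) (h n x)) = x"
  and \<beta>_right: "x \<in> carrier (N n) \<Longrightarrow> \<beta> n x \<oplus>\<^bsub>N n\<^esub> \<delta> (n + 1) (h n (\<beta> n x)) = x"
  using gr_inv_left[OF invertible_B, of x n] gr_inv_right[OF invertible_B, of x n]
  by (simp_all add: \<alpha>_def \<beta>_def gr_add_def gr_comp_def gr_id_def del: hom_add)

text \<open>Since \<open>A h = h + h \<delta> h = h B\<close>, writing
  \<open>x = B (\<beta> x)\<close> gives \<open>h x = A (h (\<beta> x))\<close>, and \<alpha>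
  removes A.\<close>

lemma \<alpha>_h:
  assumes x: "x \<in> carrier (N n)"
  shows "\<alpha> (n + 1) (h n x) = h n (\<beta> n x)"
proof -
  have "h n x = h n (\<beta> n x \<oplus>\<^bsub>N n\<^esub> \<delta> (n + 1) (h n (\<beta> n x)))"
    using x by (simp only: \<beta>_right)
  also have "\<dots> = h n (\<beta> n x) \<oplus>\<^bsub>N (n + 1)\<^esub> h n (\<delta> (n + 1) (h n (\<beta> n x)))"
    using x by simp
  finally show ?thesis
    using \<alpha>_left[of "h n (\<beta> n x)" "n + 1"] x by (simp del: hom_add)
qed

text \<open>The same argument with \<open>\<delta> A = B \<delta>\<close>, starting from
  \<open>x = A (\<alpha> x)\<close>.\<close>

lemma \<delta>_\<alpha>:
  assumes x: "x \<in> carrier (N n)"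
  shows "\<delta> n (\<alpha> n x) = \<beta> (n - 1) (\<delta> n x)"
proof -
  have "\<delta> n x = \<delta> n (\<alpha> n x \<oplus>\<^bsub>N n\<^esub> h (n - 1) (\<delta> n (\<alpha> n x)))"
    using x by (simp only: \<alpha>_right)
  also have "\<dots> = \<delta> n (\<alpha> n x) \<oplus>\<^bsub>N (n - 1)\<^esub> \<delta> n (h (n - 1) (\<delta> n (\<alpha> n x)))"
    using x by simp
  finally show ?thesis
    using \<beta>_left[of "\<delta> n (\<alpha> n x)" "n - 1"] x by (simp del: hom_add)
qed

section \<open>Compatibility with the perturbed differentials\<close>

lemma \<alpha>_eqI:
  assumes "y \<in> carrier (N n)" "x = y \<oplus>\<^bsub>N n\<^esub> h (n - 1) (\<delta> n y)"
  shows "\<alpha> n x = y"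
  using assms \<alpha>_left by simp

text \<open>Multiplying by A removes the outer \<alpha>: with \<open>y = \<alpha> (nabla x)\<close>,
  it remains to show that \<open>nabla ((dM + D) x) = A (d' y)\<close>.\<close>

lemma \<alpha>_nabla_chain_map:
  assumes x: "x \<in> carrier (M n)"
  shows "d' n (\<alpha> n (nabla n x)) = \<alpha> (n - 1) (nabla (n - 1) (dM' n x))"
proof (rule \<alpha>_eqI[symmetric])
  define y where "y = \<alpha> n (nabla n x)"
  have y [simp]: "y \<in> carrier (N n)"
    using x by (simp add: y_def)
  show "d' n (\<alpha> n (nabla n x)) \<in> carrier (N (n - 1))"
    using x by (simp add: gr_add_def)
  \<comment> \<open>By the choice of \<open>y\<close>, \<open>nabla x = A y\<close>, and
    \<open>nabla\<close> commutes with the unperturbed differentials.\<close>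
  have "nabla (n - 1) (dM n x) = d n (y \<oplus>\<^bsub>N n\<^esub> h (n - 1) (\<delta> n y))"
    using x by (simp add: y_def \<alpha>_right d_nabla del: hom_add)
  then have "nabla (n - 1) (dM' n x) =
      d n y \<oplus>\<^bsub>N (n - 1)\<^esub> d n (h (n - 1) (\<delta> n y)) \<oplus>\<^bsub>N (n - 1)\<^esub> nabla (n - 1) (\<pi> (n - 1) (\<delta> n y))"
    using x by (simp add: gr_add_def D_apply y_def)
  also have "\<dots> = d' n y \<oplus>\<^bsub>N (n - 1)\<^esub> h (n - 2) (\<delta> (n - 1) (d' n y))"
  proof -
    \<comment> \<open>The homotopy identity at \<open>\<delta> y\<close>; its summand
      \<open>h d \<delta> y\<close> cancels against
      \<open>h \<delta> d y + h \<delta> \<delta> y\<close>.\<close>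
    have "\<delta> n y = d n (h (n - 1) (\<delta> n y)) \<oplus>\<^bsub>N (n - 1)\<^esub> h (n - 2) (d (n - 1) (\<delta> n y))
        \<oplus>\<^bsub>N (n - 1)\<^esub> nabla (n - 1) (\<pi> (n - 1) (\<delta> n y))"
      using homotopy[of "\<delta> n y" "n - 1"] by simp
    from N.add_eq_cancel_zero[OF this h_perturbation_eq[OF y], of "d n y"] show ?thesis
      by (simp add: gr_add_def)
  qed
  finally show "nabla (n - 1) (dM' n x) = d' n (\<alpha> n (nabla n x)) \<oplus>\<^bsub>N (n - 1)\<^esub>
      h (n - 1 - 1) (\<delta> (n - 1) (d' n (\<alpha> n (nabla n x))))"
    by (simp add: y_def)
qed

lemma \<pi>_\<beta>_chain_map:
  assumes x: "x \<in> carrier (N n)"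
  shows "dM' n (\<pi> n (\<beta> n x)) = \<pi> (n - 1) (\<beta> (n - 1) (d' n x))"
proof -
  define y where "y = \<beta> n x"
  have y [simp]: "y \<in> carrier (N n)"
    using x by (simp add: y_def)
  have x_eq: "x = y \<oplus>\<^bsub>N n\<^esub> \<delta> (n + 1) (h n y)"
    using x by (simp add: y_def \<beta>_right)
  \<comment> \<open>Equivalent, after applying B, to
    \<open>d' (B y) = B (d y) + \<delta> nabla \<pi> y\<close>.\<close>
  have "\<beta> (n - 1) (d' n x) = d n y \<oplus>\<^bsub>N (n - 1)\<^esub> \<beta> (n - 1) (\<delta> n (nabla n (\<pi> n y)))"
  proof -
    have "\<delta> n y = \<delta> n (d (n + 1) (h n y) \<oplus>\<^bsub>N n\<^esub> h (n - 1) (d n y) \<oplus>\<^bsub>N n\<^esub> nabla n (\<pi> n y))"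
      using homotopy[of y n] by simp
    \<comment> \<open>Reordered so that \<open>\<delta> d h y\<close>, the summand to be cancelled
      by the perturbation relation at \<open>h y\<close>, stands in the middle.\<close>
    then have \<delta>_y: "\<delta> n y = \<delta> n (h (n - 1) (d n y)) \<oplus>\<^bsub>N (n - 1)\<^esub> \<delta> n (d (n + 1) (h n y))
        \<oplus>\<^bsub>N (n - 1)\<^esub> \<delta> n (nabla n (\<pi> n y))"
      by (simp add: N.add.m_ac)
    have "\<delta> n (d (n + 1) (h n y)) \<oplus>\<^bsub>N (n - 1)\<^esub>
        (d n (\<delta> (n + 1) (h n y)) \<oplus>\<^bsub>N (n - 1)\<^esub> \<delta> n (\<delta> (n + 1) (h n y))) = \<zero>\<^bsub>N (n - 1)\<^esub>"
      using perturbation_eq[of "h n y" "n + 1"] by (simp add: N.add.m_ac)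
    from N.add_eq_cancel_zero[OF \<delta>_y this, of "d n y"]
    have "d' n x = d n y \<oplus>\<^bsub>N (n - 1)\<^esub> \<delta> n (h (n - 1) (d n y))
        \<oplus>\<^bsub>N (n - 1)\<^esub> \<delta> n (nabla n (\<pi> n y))"
      by (simp add: gr_add_def x_eq N.add.m_ac)
    then show ?thesis
      using \<beta>_left[of "d n y" "n - 1"] by simp
  qed
  \<comment> \<open>Applying \<pi> turns \<open>d y\<close> into \<open>dM (\<pi> y)\<close>, and
    \<open>\<beta> \<delta> = \<delta> \<alpha>\<close> turns the other summand into
    \<open>D (\<pi> y)\<close>.\<close>
  then show ?thesis
    by (simp add: gr_add_def D_apply \<delta>_\<alpha> d_\<pi> flip: y_def)
qed

section \<open>The perturbed homotopy identity\<close>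

lemma perturbed_homotopy:
  assumes x: "x \<in> carrier (N n)"
  shows "d' (n + 1) (\<alpha> (n + 1) (h n x)) \<oplus>\<^bsub>N n\<^esub> \<alpha> n (h (n - 1) (d' n x))
    = x \<ominus>\<^bsub>N n\<^esub> \<alpha> n (nabla n (\<pi> n (\<beta> n x)))"
proof -
  define y where "y = \<beta> n x"
  have y [simp]: "y \<in> carrier (N n)"
    using x by (simp add: y_def)
  have x_eq: "x = y \<oplus>\<^bsub>N n\<^esub> \<delta> (n + 1) (h n y)"
    using x by (simp add: y_def \<beta>_right)
  \<comment> \<open>Because \<open>\<alpha> h = h \<beta>\<close>, this is the first summand
    \<open>d' (\<alpha> (h x))\<close> of the goal.\<close>
  define z where "z = d' (n + 1) (h n y)"
  have z [simp]: "z \<in> carrier (N n)"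
    by (simp add: z_def gr_add_def)
  have [simp]: "d' n x \<in> carrier (N (n - 1))"
    using x by (simp add: gr_add_def)
  \<comment> \<open>The relation \<open>A d' h + h d' B + nabla \<pi> = A B\<close> evaluated at
    \<open>y\<close>, where \<open>B y = x\<close>. Applying \<alpha> then removes A from both
    sides.\<close>
  have "z \<oplus>\<^bsub>N n\<^esub> h (n - 1) (\<delta> n z) \<oplus>\<^bsub>N n\<^esub> h (n - 1) (d' n x) \<oplus>\<^bsub>N n\<^esub> nabla n (\<pi> n y)
      = x \<oplus>\<^bsub>N n\<^esub> h (n - 1) (\<delta> n x)"
    using N.add_eq_cancel_zero'[OF homotopy[of y n] h_perturbation_eq[of "h n y" "n + 1", simplified],
        of "\<delta> (n + 1) (h n y)" "h (n - 1) (\<delta> n y)"]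
    by (simp add: x_eq z_def gr_add_def)
  then have "\<alpha> n (z \<oplus>\<^bsub>N n\<^esub> h (n - 1) (\<delta> n z) \<oplus>\<^bsub>N n\<^esub> h (n - 1) (d' n x) \<oplus>\<^bsub>N n\<^esub> nabla n (\<pi> n y)) = x"
    using x by (simp add: \<alpha>_left del: hom_add)
  \<comment> \<open>This is \<open>\<alpha> (A z) = z\<close>, in the expanded form that arises when
    \<alpha> is distributed over the sum above.\<close>
  moreover have "\<alpha> n z \<oplus>\<^bsub>N n\<^esub> \<alpha> n (h (n - 1) (\<delta> n z)) = z"
    using \<alpha>_left[OF z] by simp
  ultimately have "z \<oplus>\<^bsub>N n\<^esub> \<alpha> n (h (n - 1) (d' n x)) \<oplus>\<^bsub>N n\<^esub> \<alpha> n (nabla n (\<pi> n y)) = x"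
    by simp
  moreover have "d' (n + 1) (\<alpha> (n + 1) (h n x)) = z"
    using x by (simp add: z_def y_def \<alpha>_h)
  ultimately show ?thesis
    using x by (simp add: N.eq_minus_iff flip: y_def)
qed

text \<open>By the commutation rule, \<open>\<alpha> h \<alpha> h = \<alpha> h h \<beta>\<close>,
  and \<open>h h = 0\<close>.\<close>

lemma \<alpha>_h_square:
  assumes x: "x \<in> carrier (N n)"
  shows "\<alpha> (n + 2) (h (n + 1) (\<alpha> (n + 1) (h n x))) = \<zero>\<^bsub>N (n + 2)\<^esub>"
  using x gr_hom_zero[OF hom_\<alpha>, of "n + 2"] by (simp add: \<alpha>_h hh module_N)

section \<open>Injectivity, surjectivity and the perturbed complexes\<close>

lemma bij_\<alpha>: "bij_betw (\<alpha> n) (carrier (N n)) (carrier (N n))"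
  and bij_\<beta>: "bij_betw (\<beta> n) (carrier (N n)) (carrier (N n))"
  using bij_betw_inv_into[OF gr_inv_bij_betw[OF invertible_A, of n]]
    bij_betw_inv_into[OF gr_inv_bij_betw[OF invertible_B, of n]]
  by (simp_all add: \<alpha>_def \<beta>_def gr_inv_def)

lemma inj_\<alpha>_nabla: "inj_on (\<lambda>x. \<alpha> n (nabla n x)) (carrier (M n))"
proof -
  have "inj_on (nabla n) (carrier (M n))"
    using contraction by (simp add: weak_contraction_def)
  moreover have "inj_on (\<alpha> n) (nabla n ` carrier (M n))"
    using bij_\<alpha>[of n] by (auto simp: bij_betw_def elim!: inj_on_subset)
  ultimately show ?thesis
    using comp_inj_on[of "nabla n" _ "\<alpha> n"] by (simp add: comp_def)
qed

lemma surj_\<pi>_\<beta>: "(\<lambda>x. \<pi> n (\<beta> n x)) ` carrier (N n) = carrier (M n)"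
proof -
  have "\<pi> n ` \<beta> n ` carrier (N n) = carrier (M n)"
    using contraction bij_\<beta>[of n] by (simp add: weak_contraction_def bij_betw_def)
  then show ?thesis
    by (simp add: image_image)
qed

text \<open>There is no circularity: the intertwining identity for \<open>\<alpha> nabla\<close> was
  proved on elements, without assuming that \<open>dM + D\<close> squares to zero.\<close>

lemma chain_complex_M: "chain_complex R M dM'"
proof -
  have hom: "dM' \<in> gr_hom R M M (-1)"
    by (intro gr_hom_gr_add hom_dM hom_D module_M)
  note dM' = gr_hom_closed[OF hom]
  have "dM' (n - 1) (dM' n x) = \<zero>\<^bsub>M (n - 2)\<^esub>" if x: "x \<in> carrier (M n)" for n x
  proof (rule inj_onD[OF inj_\<alpha>_nabla[of "n - 2"]])
    \<comment> \<open>The intertwining identity is used twice, at \<open>dM' x\<close> in degree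
      \<open>n - 1\<close> and at \<open>x\<close> in degree \<open>n\<close>.\<close>
    have "\<alpha> (n - 2) (nabla (n - 2) (dM' (n - 1) (dM' n x))) = d' (n - 1) (d' n (\<alpha> n (nabla n x)))"
      using x \<alpha>_nabla_chain_map[of "dM' n x" "n - 1"] by (simp add: \<alpha>_nabla_chain_map dM')
    also have "\<dots> = \<alpha> (n - 2) (nabla (n - 2) \<zero>\<^bsub>M (n - 2)\<^esub>)"
      using x gr_hom_zero[OF hom_\<alpha>, of "n - 2"] gr_hom_zero[OF hom_nabla, of "n - 2"]
      by (simp add: d'_d' module_M module_N)
    finally show "\<alpha> (n - 2) (nabla (n - 2) (dM' (n - 1) (dM' n x)))
        = \<alpha> (n - 2) (nabla (n - 2) \<zero>\<^bsub>M (n - 2)\<^esub>)" .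
  qed (use x in \<open>simp_all add: dM'\<close>)
  with hom show ?thesis
    by (simp add: chain_complex_def gr_eq_def gr_comp_def gr_zero_def module_M)
qed

lemma chain_complex_N: "chain_complex R N d'"
  using perturbation
  by (simp add: chain_complex_def perturbation_def module_N gr_hom_gr_add hom_d)

theorem perturbed_contraction:
  "weak_contraction R M dM' N d' (\<alpha> \<circ>\<^bsub>0\<^esub> nabla) (\<pi> \<circ>\<^bsub>0\<^esub> \<beta>) (\<alpha> \<circ>\<^bsub>1\<^esub> h)"
proof -
  have "(\<alpha> \<circ>\<^bsub>0\<^esub> nabla) \<in> gr_hom R M N 0" "(\<pi> \<circ>\<^bsub>0\<^esub> \<beta>) \<in> gr_hom R N M 0"
      "(\<alpha> \<circ>\<^bsub>1\<^esub> h) \<in> gr_hom R N N 1"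
    by (rule gr_hom_comp hom_nabla hom_\<alpha> hom_\<beta> hom_\<pi> hom_h | simp)+
  then show ?thesis
    unfolding weak_contraction_def
    using chain_complex_M chain_complex_N inj_\<alpha>_nabla surj_\<pi>_\<beta> \<alpha>_nabla_chain_map
      \<pi>_\<beta>_chain_map perturbed_homotopy \<alpha>_h_square
    \<comment> \<open>Only the degree zero sum from \<open>hom_diff\<close> is unfolded; the
      differentials \<open>dM'\<close> and \<open>d'\<close> stay folded so that the facts above
      match.\<close>
    by (simp add: chain_map_def gr_eq_def gr_comp_def hom_diff_def gr_add_def[of N 0] gr_diff_def
        gr_zero_def gr_id_def add.commute[of 2])
qed

end

theorem corollary5p4:
  fixes R :: "('r, 'x) ring_scheme"
    and M :: "int \<Rightarrow> ('r, 'a, 'y) module_scheme" and N :: "int \<Rightarrow> ('r, 'b, 'z) module_scheme"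
    and dM :: "('a, 'a) gmap" and dN \<delta> h \<alpha> \<beta> :: "('b, 'b) gmap"
    and nabla :: "('a, 'b) gmap" and \<pi> :: "('b, 'a) gmap"
  assumes "cring R"
    and "weak_contraction R M dM N dN nabla \<pi> h"
    and "perturbation R N dN \<delta>"
    and "gr_invertible R N (gr_add N 0 gr_id (h \<circ>\<^bsub>-1\<^esub> \<delta>))"
    and "gr_invertible R N (gr_add N 0 gr_id (\<delta> \<circ>\<^bsub>1\<^esub> h))"
  defines "\<alpha> \<equiv> gr_inv N (gr_add N 0 gr_id (h \<circ>\<^bsub>-1\<^esub> \<delta>))"
    and "\<beta> \<equiv> gr_inv N (gr_add N 0 gr_id (\<delta> \<circ>\<^bsub>1\<^esub> h))"
    and "D \<equiv> \<pi> \<circ>\<^bsub>-1\<^esub> \<delta> \<circ>\<^bsub>0\<^esub> \<alpha> \<circ>\<^bsub>0\<^esub> nabla"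
  shows "gr_eq M D (\<pi> \<circ>\<^bsub>-1\<^esub> \<beta> \<circ>\<^bsub>-1\<^esub> \<delta> \<circ>\<^bsub>0\<^esub> nabla) \<and>
    gr_eq N (\<alpha> \<circ>\<^bsub>1\<^esub> h) (h \<circ>\<^bsub>0\<^esub> \<beta>) \<and>
    weak_contraction R M (gr_add M (-1) dM D) N (gr_add N (-1) dN \<delta>)
      (\<alpha> \<circ>\<^bsub>0\<^esub> nabla) (\<pi> \<circ>\<^bsub>0\<^esub> \<beta>) (\<alpha> \<circ>\<^bsub>1\<^esub> h)"
proof -
  interpret P: perturbed_weak_contraction R M N dM dN \<delta> h nabla \<pi>
    by unfold_locales (use assms in auto)
  have \<alpha>: "\<alpha> = P.\<alpha>" and \<beta>: "\<beta> = P.\<beta>"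
    by (simp_all add: \<alpha>_def \<beta>_def P.\<alpha>_def P.\<beta>_def)
  then have D: "D = P.D"
    by (simp add: D_def P.D_def)
  \<comment> \<open>The two expressions for \<open>D\<close> agree by
    \<open>\<delta> \<alpha> = \<beta> \<delta>\<close>, those for the perturbed homotopy by
    \<open>\<alpha> h = h \<beta>\<close>.\<close>
  have "gr_eq M D (\<pi> \<circ>\<^bsub>-1\<^esub> \<beta> \<circ>\<^bsub>-1\<^esub> \<delta> \<circ>\<^bsub>0\<^esub> nabla)"
    by (simp add: D \<beta> gr_eq_def gr_comp_def P.D_apply P.\<delta>_\<alpha>)
  moreover have "gr_eq N (\<alpha> \<circ>\<^bsub>1\<^esub> h) (h \<circ>\<^bsub>0\<^esub> \<beta>)"
    by (simp add: \<alpha> \<beta> gr_eq_def gr_comp_def P.\<alpha>_h)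
  ultimately show ?thesis
    using P.perturbed_contraction by (simp add: \<alpha> \<beta> D)
qed

end
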